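(* Consider the pseudosphere (lower component) parametrized by $$\mathbf{r}(p,q)=\left(-\frac{\cos q}{\cosh p},\ \frac{\sin q}{\cosh p},\ p-\tanh p\right),\qquad p\le 0,\ q\in\mathbb{R}.$$ (i) The angle $\varphi$ that the tangent to the meridian of the pseudosphere makes with the $z$ axis (the rotation axis) is $$\varphi=2\tan^{-1}\left(e^{-p}\right),$$ and $\varphi$, regarded as a function of $(p,q)$, is a solution (the so-called "one-soliton" solution) of the sine–Gordon equation $$\frac{\partial^2\varphi}{\partial p^2}-\frac{\partial^2\varphi}{\partial q^2}=\sin\varphi\cos\varphi .$$ (ii) The angle $\varphi$ varies from $\frac{\pi}{2}$ to $\pi$ in the process of focusing (i.e. as $p$ goes from $0$ to $-\infty$), and from $\pi$ to $\frac{\pi}{2}$ in the process of defocusing (i.e. as $p$ goes from $-\infty$ to $0$).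
   Context: The pseudosphere is the surface of revolution about the $z$ axis generated by the tractrix $x=-\sin\varphi$, $z=-\left(\cos\varphi+\ln\left|\tan\frac{\varphi}{2}\right|\right)$; meridians are the curves $q=\mathrm{const}$. The rim corresponds to $p=0$ (where the surface has a cusp, the tangent to the meridian being understood as a limit) and the downward vertex to $p\to-\infty$. For $p<0$ the angle $\varphi\in(0,\pi)$ is the angle between the positive $z$ direction and the tangent to the meridian oriented toward the downward vertex (direction of decreasing $p$). "Focusing" means motion along a meridian from the rim toward the vertex ($p$ from $0$ to $-\infty$), "defocusing" the reverse motion. *)

theory Defs
  imports "HOL-Analysis.Analysis"
begin

text \<open>Parametrization of the (lower component of the) pseudosphere; it is used for \<open>p \<le> 0\<close>.\<close>

definition pseudosphere :: "real \<Rightarrow> real \<Rightarrow> real ^ 3" where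
  "pseudosphere p q = vector [- (cos q / cosh p), sin q / cosh p, p - tanh p]"

definition vec_angle :: "'a::real_inner \<Rightarrow> 'a \<Rightarrow> real" where
  "vec_angle u v = arccos (inner u v / (norm u * norm v))"

text \<open>
  The minus sign orients the meridian \<open>q = const\<close> toward the vertex (decreasing \<open>p\<close>).
  At the rim \<open>p = 0\<close> the derivative of the parametrization vanishes, so there the tangent is the
  one-sided limit of the unit tangents at points of the surface.
\<close>

definition meridian_unit_tangent :: "real \<Rightarrow> real \<Rightarrow> real ^ 3" where
  "meridian_unit_tangent p q = sgn (- vector_derivative (\<lambda>s. pseudosphere s q) (at p))"

definition meridian_tangent :: "real \<Rightarrow> real \<Rightarrow> real ^ 3" where
  "meridian_tangent p q =
     (if p = 0 then Lim (at_left 0) (\<lambda>s. meridian_unit_tangent s q)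
      else meridian_unit_tangent p q)"

definition meridian_angle :: "real \<Rightarrow> real \<Rightarrow> real" where
  "meridian_angle p q = vec_angle (axis 3 1) (meridian_tangent p q)"

text \<open>
  Classical solution on \<open>P \<times> Q\<close>: the functions \<open>up\<close>, \<open>upp\<close>, \<open>uq\<close>, \<open>uqq\<close> are the first and second
  partial derivatives of \<open>u\<close> (one-sided at boundary points that belong to \<open>P\<close> or \<open>Q\<close>).
\<close>

definition sine_gordon_solution_on ::
    "real set \<Rightarrow> real set \<Rightarrow> (real \<Rightarrow> real \<Rightarrow> real) \<Rightarrow> bool" where
  "sine_gordon_solution_on P Q u \<longleftrightarrow>
     (\<exists>up upp uq uqq. \<forall>p\<in>P. \<forall>q\<in>Q.
        ((\<lambda>s. u s q) has_real_derivative up p q) (at p within P) \<and>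
        ((\<lambda>s. up s q) has_real_derivative upp p q) (at p within P) \<and>
        ((\<lambda>t. u p t) has_real_derivative uq p q) (at q within Q) \<and>
        ((\<lambda>t. uq p t) has_real_derivative uqq p q) (at q within Q) \<and>
        upp p q - uqq p q = sin (u p q) * cos (u p q))"

end

theory Submission
  imports Defs
begin

text \<open>
  The derivative of the meridian is \<open>tanh p\<close> times a unit vector with \<open>z\<close>-component \<open>tanh p\<close>.
  For \<open>p < 0\<close> the factor \<open>tanh p\<close> is negative, so this unit vector is the tangent oriented toward
  the vertex; being continuous in \<open>p\<close>, it is also the limiting tangent at the cusp \<open>p = 0\<close>.
  Hence \<open>cos \<phi> = tanh p\<close> and \<open>sin \<phi> = 1 / cosh p\<close>, so that \<open>\<phi>' = - (1 / cosh p)\<close> and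
  \<open>\<phi>'' = tanh p / cosh p = sin \<phi> cos \<phi>\<close>.
\<close>

lemma cos_double_arctan: "cos (2 * arctan x) = (1 - x\<^sup>2) / (1 + x\<^sup>2)"
proof -
  have "1 + x\<^sup>2 > 0" by (simp add: add_pos_nonneg)
  then show ?thesis
    by (simp add: cos_double cos_arctan sin_arctan power_divide diff_divide_distrib)
qed

lemma sin_double_arctan: "sin (2 * arctan x) = 2 * x / (1 + x\<^sup>2)"
proof -
  have "1 + x\<^sup>2 > 0" by (simp add: add_pos_nonneg)
  then show ?thesis
    by (simp add: sin_double cos_arctan sin_arctan flip: power2_eq_square)
qed

text \<open>With \<open>x = exp (- p)\<close> the half-angle formula becomes
  \<open>(1 - exp (- 2 * p)) / (1 + exp (- 2 * p))\<close>.\<close>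

lemma cos_double_arctan_exp_minus: "cos (2 * arctan (exp (- p))) = tanh p" for p :: real
proof -
  have "1 + (exp (- p))\<^sup>2 > 0" by (simp add: add_pos_nonneg)
  then show ?thesis
    by (simp add: cos_double_arctan tanh_real_altdef flip: exp_double)
qed

lemma sin_double_arctan_exp_minus: "sin (2 * arctan (exp (- p))) = 1 / cosh p" for p :: real
proof -
  have "1 + (exp (- p))\<^sup>2 > 0" "exp p + exp (- p) > 0" by (auto intro!: add_pos_nonneg add_pos_pos)
  then show ?thesis
    by (simp add: sin_double_arctan cosh_field_def exp_minus field_simps power2_eq_square)
qed

text \<open>Since \<open>arccos\<close> inverts \<open>cos\<close> only on \<open>[0, pi]\<close>,
  the bound on \<open>arctan\<close> is what makes the inversion legitimate.\<close>

lemma arccos_tanh: "arccos (tanh p) = 2 * arctan (exp (- p))" for p :: real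
proof -
  have "2 * arctan (exp (- p)) \<le> pi"
    using arctan_ubound[of "exp (- p)"] by linarith
  then show ?thesis
    using arccos_cos[of "2 * arctan (exp (- p))"] by (simp add: cos_double_arctan_exp_minus)
qed

text \<open>Over constant basis vectors, differentiation and continuity reduce to the scalar
  coefficients.\<close>

lemma vector_3_eq_axis_sum:
  "(vector [a, b, c] :: real ^ 3) = a *\<^sub>R axis 1 1 + b *\<^sub>R axis 2 1 + c *\<^sub>R axis 3 1"
  by (simp add: vec_eq_iff forall_3 axis_def)

definition tractrix_direction :: "real \<Rightarrow> real \<Rightarrow> real ^ 3" where
  "tractrix_direction p q = vector [cos q / cosh p, - (sin q / cosh p), tanh p]"

text \<open>The \<open>z\<close>-component is \<open>1 - (1 - (tanh p)\<^sup>2)\<close>, so all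
  three components share the factor \<open>tanh p\<close>, the source of the cusp at the
  rim.\<close>

lemma pseudosphere_has_vector_derivative:
  "((\<lambda>s. pseudosphere s q) has_vector_derivative
     tanh p *\<^sub>R tractrix_direction p q) (at p)"
proof -
  have "((\<lambda>s. (- (cos q / cosh s)) *\<^sub>R axis 1 1 + (sin q / cosh s) *\<^sub>R axis 2 1
          + (s - tanh s) *\<^sub>R (axis 3 1 :: real ^ 3)) has_vector_derivative
        (cos q * sinh p / (cosh p)\<^sup>2) *\<^sub>R axis 1 1 + (- (sin q * sinh p / (cosh p)\<^sup>2)) *\<^sub>R axis 2 1
          + (tanh p)\<^sup>2 *\<^sub>R axis 3 1) (at p)"
    by (auto intro!: derivative_eq_intros simp: power2_eq_square
          simp flip: has_real_derivative_iff_has_vector_derivative)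
  then show ?thesis
    by (simp add: pseudosphere_def tractrix_direction_def vector_3_eq_axis_sum tanh_def
          power2_eq_square scaleR_add_right field_simps)
qed

lemma norm_tractrix_direction: "norm (tractrix_direction p q) = 1"
proof -
  have "(cos q / cosh p)\<^sup>2 + (sin q / cosh p)\<^sup>2 + (tanh p)\<^sup>2 = (1 + (sinh p)\<^sup>2) / (cosh p)\<^sup>2"
    by (simp add: power_divide tanh_def flip: add_divide_distrib)
  also have "\<dots> = 1"
    by (simp add: cosh_square_eq add_ac add_nonneg_eq_0_iff)
  finally show ?thesis
    by (simp add: tractrix_direction_def norm_vec_def L2_set_def sum_3)
qed

lemma meridian_unit_tangent_eq:
  assumes "p < 0"
  shows "meridian_unit_tangent p q = tractrix_direction p q"
proof -
  have "vector_derivative (\<lambda>s. pseudosphere s q) (at p) = tanh p *\<^sub>R tractrix_direction p q"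
    by (rule vector_derivative_at[OF pseudosphere_has_vector_derivative])
  then have "meridian_unit_tangent p q = sgn ((- tanh p) *\<^sub>R tractrix_direction p q)"
    by (simp add: meridian_unit_tangent_def)
  \<comment> \<open>Here \<open>- tanh p\<close> is positive, so \<open>sgn\<close> removes it
    without reversing the direction.\<close>
  also have "\<dots> = tractrix_direction p q"
    using assms by (simp add: sgn_scaleR sgn_div_norm norm_tractrix_direction)
  finally show ?thesis .
qed

lemma continuous_tractrix_direction: "isCont (\<lambda>p. tractrix_direction p q) p"
  unfolding tractrix_direction_def vector_3_eq_axis_sum
  by (intro continuous_intros) auto

lemma meridian_tangent_eq:
  assumes "p \<le> 0"
  shows "meridian_tangent p q = tractrix_direction p q"
proof (cases "p = 0")
  case True
  have "((\<lambda>s. tractrix_direction s q) \<longlongrightarrow> tractrix_direction 0 q) (at_left 0)"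
    using continuous_tractrix_direction
    by (simp add: isCont_def filterlim_at_split)
  \<comment> \<open>The limit must be one-sided: for \<open>s > 0\<close> the sign of
    \<open>tanh s\<close> flips the unit tangent.\<close>
  moreover have "\<forall>\<^sub>F s in at_left 0. tractrix_direction s q = meridian_unit_tangent s q"
    using eventually_at_left_real[of "-1" 0]
    by (auto elim!: eventually_mono simp: meridian_unit_tangent_eq)
  ultimately have "((\<lambda>s. meridian_unit_tangent s q) \<longlongrightarrow> tractrix_direction 0 q) (at_left 0)"
    by (rule Lim_transform_eventually)
  then show ?thesis
    by (simp add: True meridian_tangent_def tendsto_Lim)
next
  case False
  then show ?thesis
    using assms by (simp add: meridian_tangent_def meridian_unit_tangent_eq)
qed

lemma meridian_angle_eq:
  assumes "p \<le> 0"
  shows "meridian_angle p q = 2 * arctan (exp (- p))"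
proof -
  have "inner (axis 3 1) (tractrix_direction p q) = tanh p"
    by (simp add: inner_axis' tractrix_direction_def)
  then show ?thesis
    using assms
    by (simp add: meridian_angle_def vec_angle_def meridian_tangent_eq
          norm_tractrix_direction arccos_tanh)
qed

text \<open>A general \<open>S\<close> covers the one-sided derivative at the rim.\<close>

lemma double_arctan_exp_minus_has_real_derivative:
  "((\<lambda>s. 2 * arctan (exp (- s))) has_real_derivative - (1 / cosh p)) (at p within S)"
proof -
  have "1 + (exp (- p))\<^sup>2 > 0" "exp p + exp (- p) > 0" by (auto intro!: add_pos_nonneg add_pos_pos)
  then have "2 * (exp (- p) / (1 + (exp (- p))\<^sup>2)) = 1 / cosh p"
    by (simp add: cosh_field_def exp_minus field_simps power2_eq_square)
  then show ?thesis
    by (auto intro!: derivative_eq_intros simp: field_simps)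
qed

lemma sech_has_real_derivative:
  "((\<lambda>s. - (1 / cosh s)) has_real_derivative tanh p / cosh p) (at p within S)"
  for p :: real
  by (auto intro!: derivative_eq_intros simp: tanh_def power2_eq_square)

lemma sine_gordon_meridian_angle: "sine_gordon_solution_on {..0} UNIV meridian_angle"
  unfolding sine_gordon_solution_on_def
\<comment> \<open>The partial derivatives stay schematic and are fixed by the \<open>show\<close>
  statements below.\<close>
proof (intro exI ballI conjI)
  fix p q :: real
  assume p: "p \<in> {..0}"
  \<comment> \<open>The closed form is known only for \<open>p \<le> 0\<close>, which suffices for a
    derivative within \<open>{..0}\<close>; the radius 1 is arbitrary.\<close>
  show "((\<lambda>s. meridian_angle s q) has_real_derivative - (1 / cosh p)) (at p within {..0})"
    by (rule has_field_derivative_transform_within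
          [OF double_arctan_exp_minus_has_real_derivative zero_less_one p])
      (simp add: meridian_angle_eq)
  show "((\<lambda>s. - (1 / cosh s)) has_real_derivative tanh p / cosh p) (at p within {..0})"
    by (rule sech_has_real_derivative)
  show "((\<lambda>t. meridian_angle p t) has_real_derivative 0) (at q)"
    using p by (simp add: meridian_angle_eq)
  show "((\<lambda>t. 0) has_real_derivative 0) (at q)"
    by simp
  show "tanh p / cosh p - 0 = sin (meridian_angle p q) * cos (meridian_angle p q)"
    using p by (simp add: meridian_angle_eq sin_double_arctan_exp_minus cos_double_arctan_exp_minus)
qed

lemma continuous_on_meridian_angle: "continuous_on {..0} (\<lambda>p. meridian_angle p q)"
proof -
  have "continuous_on {..0} (\<lambda>p::real. 2 * arctan (exp (- p)))"
    by (intro continuous_intros)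
  then show ?thesis
    by (rule continuous_on_eq) (simp add: meridian_angle_eq)
qed

lemma meridian_angle_rim: "meridian_angle 0 q = pi / 2"
  by (simp add: meridian_angle_eq arctan_one)

text \<open>\<open>arctan\<close> increases while \<open>exp (- p)\<close> decreases; this one fact
  gives the monotonicity of both focusing and defocusing.\<close>

lemma meridian_angle_strict_antimono:
  assumes "s < t" "t \<le> 0"
  shows "meridian_angle t q < meridian_angle s q"
  using assms by (simp add: meridian_angle_eq arctan_less_iff)

text \<open>Toward the vertex \<open>exp (- p)\<close> grows without bound, so its
  \<open>arctan\<close> tends to \<open>pi / 2\<close>.\<close>

lemma meridian_angle_tendsto_vertex: "((\<lambda>p. meridian_angle p q) \<longlongrightarrow> pi) at_bot"
proof -
  have "filterlim (\<lambda>p::real. exp (- p)) at_top at_bot"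
    by (rule filterlim_compose[OF exp_at_top filterlim_uminus_at_top_at_bot])
  then have "((\<lambda>p::real. 2 * arctan (exp (- p))) \<longlongrightarrow> 2 * (pi / 2)) at_bot"
    by (intro tendsto_mult tendsto_const filterlim_compose[OF tendsto_arctan_at_top])
  moreover have "\<forall>\<^sub>F p in at_bot. 2 * arctan (exp (- p)) = meridian_angle p q"
    using eventually_le_at_bot[of "0::real"] by eventually_elim (simp add: meridian_angle_eq)
  ultimately show ?thesis
    using Lim_transform_eventually by fastforce
qed

theorem proposition5:
  shows
    "(\<forall>p q. p \<le> 0 \<longrightarrow> meridian_angle p q = 2 * arctan (exp (- p))) \<and>
     sine_gordon_solution_on {..0} UNIV meridian_angle \<and>
     \<comment> \<open>focusing: \<open>p\<close> decreases from \<open>0\<close> to \<open>-\<infinity>\<close>\<close>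
     (\<forall>q. continuous_on {..0} (\<lambda>p. meridian_angle p q) \<and>
          meridian_angle 0 q = pi / 2 \<and>
          monotone_on {..0} (>) (<) (\<lambda>p. meridian_angle p q) \<and>
          ((\<lambda>p. meridian_angle p q) \<longlongrightarrow> pi) at_bot) \<and>
     \<comment> \<open>defocusing: \<open>p\<close> increases from \<open>-\<infinity>\<close> to \<open>0\<close>\<close>
     (\<forall>q. continuous_on {..0} (\<lambda>p. meridian_angle p q) \<and>
          ((\<lambda>p. meridian_angle p q) \<longlongrightarrow> pi) at_bot \<and>
          monotone_on {..0} (<) (>) (\<lambda>p. meridian_angle p q) \<and>
          meridian_angle 0 q = pi / 2)"
  using meridian_angle_eq sine_gordon_meridian_angle continuous_on_meridian_angle
    meridian_angle_rim meridian_angle_strict_antimono meridian_angle_tendsto_vertex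
  by (auto simp: monotone_on_def)

end
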